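(* Let $(X,d)$ be a metric space, let $\{f_n\}_{n\in\mathbb{N}^+}$ be a sequence of uniformly continuous maps $f_n:X\to X$ which is orbitally convergent to a uniformly continuous map $f:X\to X$, and let $x\in X$. Then the following statements are true: (i) $x\in Sh^{+}(f)$ if and only if for every $\epsilon>0$, $\bigcup_{m\geq 1}\bigcap_{n\geq m}Sh^{+}(f_n,x,\epsilon)\neq\emptyset$. (ii) $x\in Sp(f)$ if and only if for every $\epsilon>0$, $\bigcup_{m\geq 1}\bigcap_{n\geq m}Sp(f_n,x,\epsilon)\neq\emptyset$.
   Context: $\mathbb{N}=\{0,1,2,\dots\}$, $\mathbb{N}^+=\{1,2,\dots\}$; $f^k$ denotes the $k$-th iterate. The sequence $f_n$ is orbitally convergent to $f$ if for every $\epsilon>0$ there is $N\in\mathbb{N}^+$ such that $d(f_n^k(x),f^k(x))<\epsilon$ for all $n\geq N$, all $x\in X$ and all $k\in\mathbb{N}^+$. Let $g:X\to X$ be uniformly continuous. A $\delta$-pseudo orbit for $g$ through $x$ is a sequence $\{x_i\}_{i\in\mathbb{N}}$ in $X$ with $x_0=x$ and $d(g(x_i),x_{i+1})<\delta$ for each $i\in\mathbb{N}$. It is $\epsilon$-traced through $g$ by $y\in X$ if $d(g^i(y),x_i)<\epsilon$ for each $i\in\mathbb{N}$. $Sh^{+}(g,x,\epsilon)$ is the set of $\delta>0$ such that every $\delta$-pseudo orbit $\{x_i\}_{i\in\mathbb{N}}$ for $g$ through $x$ is $\epsilon$-traced through $g$ by some point of $X$. $Sh^{+}(g)$, the set of positive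 shadowable points of $g$, is the set of $x\in X$ such that for every $\epsilon>0$ there is $\delta>0$ such that every $\delta$-pseudo orbit $\{x_i\}_{i\in\mathbb{N}}$ for $g$ through $x$ is $\epsilon$-traced through $g$ by some point of $X$. $Sp(g,x,\epsilon)$ is the set of $M\in\mathbb{N}^+$ with the following property: for any finite sequence $x=x_1,x_2,\dots,x_k$ in $X$ and any integers $0\leq a_1\leq b_1<a_2\leq b_2<\dots<a_k\leq b_k$ with $a_j-b_{j-1}\geq M$ for all $2\leq j\leq k$, there is $y\in X$ such that $d(g^i(y),g^i(x_j))<\epsilon$ for all $a_j\leq i\leq b_j$ and all $1\leq j\leq k$. $Sp(g)$, the set of specification points of $g$, is the set of $x\in X$ such that for every $\epsilon>0$ there is $M\in\mathbb{N}^+$ with this property. *)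

theory Defs
  imports "HOL-Analysis.Analysis"
begin

definition orbitally_convergent ::
  "(nat \<Rightarrow> 'a \<Rightarrow> 'a) \<Rightarrow> ('a::metric_space \<Rightarrow> 'a) \<Rightarrow> bool" where
  "orbitally_convergent fs f \<longleftrightarrow>
     (\<forall>\<epsilon>>0. \<exists>N\<ge>1. \<forall>n\<ge>N. \<forall>x. \<forall>k\<ge>1. dist ((fs n ^^ k) x) ((f ^^ k) x) < \<epsilon>)"

definition pseudo_orbit ::
  "('a::metric_space \<Rightarrow> 'a) \<Rightarrow> 'a \<Rightarrow> real \<Rightarrow> (nat \<Rightarrow> 'a) \<Rightarrow> bool" where
  "pseudo_orbit g x \<delta> xs \<longleftrightarrow> xs 0 = x \<and> (\<forall>i. dist (g (xs i)) (xs (Suc i)) < \<delta>)"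

definition traced ::
  "('a::metric_space \<Rightarrow> 'a) \<Rightarrow> real \<Rightarrow> (nat \<Rightarrow> 'a) \<Rightarrow> 'a \<Rightarrow> bool" where
  "traced g \<epsilon> xs y \<longleftrightarrow> (\<forall>i. dist ((g ^^ i) y) (xs i) < \<epsilon>)"

definition Sh_plus_at :: "('a::metric_space \<Rightarrow> 'a) \<Rightarrow> 'a \<Rightarrow> real \<Rightarrow> real set" where
  "Sh_plus_at g x \<epsilon> = {\<delta>. \<delta> > 0 \<and> (\<forall>xs. pseudo_orbit g x \<delta> xs \<longrightarrow> (\<exists>y. traced g \<epsilon> xs y))}"

definition Sh_plus :: "('a::metric_space \<Rightarrow> 'a) \<Rightarrow> 'a set" where
  "Sh_plus g = {x. \<forall>\<epsilon>>0. \<exists>\<delta>>0. \<forall>xs. pseudo_orbit g x \<delta> xs \<longrightarrow> (\<exists>y. traced g \<epsilon> xs y)}"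

text \<open>
  The finite sequences are functions read at the indices \<open>1, \<dots>, k\<close> only. The gap condition
  \<open>a j - b (j - 1) \<ge> M\<close> is written additively to avoid truncated subtraction.
\<close>

definition specification_gap ::
  "('a::metric_space \<Rightarrow> 'a) \<Rightarrow> 'a \<Rightarrow> real \<Rightarrow> nat \<Rightarrow> bool" where
  "specification_gap g x \<epsilon> M \<longleftrightarrow>
     (\<forall>k\<ge>1. \<forall>(xs :: nat \<Rightarrow> 'a) (a :: nat \<Rightarrow> nat) (b :: nat \<Rightarrow> nat).
        xs 1 = x \<longrightarrow>
        (\<forall>j\<in>{1..k}. a j \<le> b j) \<longrightarrow>
        (\<forall>j\<in>{2..k}. b (j - 1) < a j) \<longrightarrow>
        (\<forall>j\<in>{2..k}. b (j - 1) + M \<le> a j) \<longrightarrow>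
        (\<exists>y. \<forall>j\<in>{1..k}. \<forall>i\<in>{a j..b j}. dist ((g ^^ i) y) ((g ^^ i) (xs j)) < \<epsilon>))"

definition Sp_at :: "('a::metric_space \<Rightarrow> 'a) \<Rightarrow> 'a \<Rightarrow> real \<Rightarrow> nat set" where
  "Sp_at g x \<epsilon> = {M. M \<ge> 1 \<and> specification_gap g x \<epsilon> M}"

definition Sp :: "('a::metric_space \<Rightarrow> 'a) \<Rightarrow> 'a set" where
  "Sp g = {x. \<forall>\<epsilon>>0. \<exists>M\<ge>1. specification_gap g x \<epsilon> M}"

end

theory Submission
  imports Defs
begin

text \<open>
  If all iterates of \<open>g\<close> and \<open>h\<close> are uniformly \<open>\<eta>\<close>-close, then a \<open>\<delta>\<close>-pseudo orbit for \<open>h\<close> is a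
  \<open>(\<delta> + \<eta>)\<close>-pseudo orbit for \<open>g\<close>, and a point tracing it through \<open>g\<close> also traces it through \<open>h\<close>
  with an error larger by \<open>\<eta>\<close>. In the specification property the orbits of both \<open>y\<close> and \<open>x\<^sub>j\<close>
  are exchanged, which costs \<open>2\<eta>\<close>, while the gap \<open>M\<close> is unchanged. Closeness is symmetric, so each
  equivalence follows by transferring between \<open>f\<close> and \<open>f\<^sub>n\<close> for large \<open>n\<close>.
\<close>

text \<open>The index \<open>k\<close> starts at 0, since tracing and specification compare orbits
  from time 0 on, whereas orbital convergence starts at 1. The case \<open>k = 0\<close> forces
  \<open>\<eta> > 0\<close>.\<close>

definition iterates_close :: "('a::metric_space \<Rightarrow> 'a) \<Rightarrow> ('a \<Rightarrow> 'a) \<Rightarrow> real \<Rightarrow> bool" where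
  "iterates_close g h \<eta> \<longleftrightarrow> (\<forall>k z. dist ((g ^^ k) z) ((h ^^ k) z) < \<eta>)"

lemma iterates_close_commute: "iterates_close g h \<eta> \<longleftrightarrow> iterates_close h g \<eta>"
  by (simp add: iterates_close_def dist_commute)

lemma orbitally_convergent_iterates_close:
  assumes "orbitally_convergent fs f" and "\<eta> > 0"
  obtains N where "N \<ge> 1" and "\<And>n. n \<ge> N \<Longrightarrow> iterates_close (fs n) f \<eta>"
proof -
  obtain N where "N \<ge> 1"
    and N: "\<forall>n\<ge>N. \<forall>x. \<forall>k\<ge>1. dist ((fs n ^^ k) x) ((f ^^ k) x) < \<eta>"
    using assms unfolding orbitally_convergent_def by blast
  have "iterates_close (fs n) f \<eta>" if "n \<ge> N" for n
    unfolding iterates_close_def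
  proof (intro allI)
    fix k z
    \<comment> \<open>For \<open>k = 0\<close> both iterates are \<open>z\<close>, so the distance
      is 0.\<close>
    show "dist ((fs n ^^ k) z) ((f ^^ k) z) < \<eta>"
      using N that \<open>\<eta> > 0\<close> by (cases "k = 0") auto
  qed
  with \<open>N \<ge> 1\<close> show thesis by (rule that)
qed

lemma pseudo_orbit_transfer:
  assumes "iterates_close g h \<eta>" and "pseudo_orbit h x \<delta> xs"
  shows "pseudo_orbit g x (\<delta> + \<eta>) xs"
  unfolding pseudo_orbit_def
proof (intro conjI allI)
  show "xs 0 = x"
    using assms(2) by (simp add: pseudo_orbit_def)
next
  fix i
  \<comment> \<open>The jump condition applies the map once, so closeness is used at
    \<open>k = 1\<close>.\<close>
  have "dist ((g ^^ 1) (xs i)) ((h ^^ 1) (xs i)) < \<eta>"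
    using assms(1) unfolding iterates_close_def by blast
  moreover have "dist (h (xs i)) (xs (Suc i)) < \<delta>"
    using assms(2) by (simp add: pseudo_orbit_def)
  ultimately show "dist (g (xs i)) (xs (Suc i)) < \<delta> + \<eta>"
    using dist_triangle[of "g (xs i)" "xs (Suc i)" "h (xs i)"] by simp
qed

lemma traced_transfer:
  assumes "iterates_close g h \<eta>" and "traced g \<epsilon> xs y"
  shows "traced h (\<epsilon> + \<eta>) xs y"
  unfolding traced_def
proof
  fix i
  have "dist ((g ^^ i) y) ((h ^^ i) y) < \<eta>" "dist ((g ^^ i) y) (xs i) < \<epsilon>"
    using assms by (simp_all add: iterates_close_def traced_def)
  then show "dist ((h ^^ i) y) (xs i) < \<epsilon> + \<eta>"
    using dist_triangle3[of "(h ^^ i) y" "xs i" "(g ^^ i) y"] by linarith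
qed

text \<open>A pseudo orbit is carried from \<open>h\<close> to \<open>g\<close>, traced there, and
  the tracing point is carried back to \<open>h\<close>. The first passage costs
  \<open>\<eta>\<close> in \<open>\<delta>\<close>, the second costs \<open>\<eta>\<close> in
  \<open>\<epsilon>\<close>.\<close>

lemma Sh_plus_at_transfer:
  assumes "iterates_close g h \<eta>" and "\<delta> + \<eta> \<in> Sh_plus_at g x \<epsilon>" and "\<delta> > 0"
  shows "\<delta> \<in> Sh_plus_at h x (\<epsilon> + \<eta>)"
  using assms pseudo_orbit_transfer traced_transfer unfolding Sh_plus_at_def by blast

lemma Sh_plus_at_mono:
  assumes "\<delta> \<in> Sh_plus_at g x \<epsilon>" and "0 < \<delta>'" "\<delta>' \<le> \<delta>" and "\<epsilon> \<le> \<epsilon>'"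
  shows "\<delta>' \<in> Sh_plus_at g x \<epsilon>'"
proof -
  have "pseudo_orbit g x \<delta> xs" if "pseudo_orbit g x \<delta>' xs" for xs
    using that \<open>\<delta>' \<le> \<delta>\<close> unfolding pseudo_orbit_def by (meson order.strict_trans2)
  moreover have "traced g \<epsilon>' xs y" if "traced g \<epsilon> xs y" for xs y
    using that \<open>\<epsilon> \<le> \<epsilon>'\<close> unfolding traced_def by (meson order.strict_trans2)
  ultimately show ?thesis
    using assms unfolding Sh_plus_at_def by blast
qed

lemma specification_gap_transfer:
  assumes close: "iterates_close g h \<eta>" and gap: "specification_gap g x \<epsilon> M"
  shows "specification_gap h x (\<epsilon> + 2 * \<eta>) M"
  unfolding specification_gap_def
proof (intro allI impI)
  fix k :: nat and xs :: "nat \<Rightarrow> 'a" and a b :: "nat \<Rightarrow> nat"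
  assume "k \<ge> 1" "xs 1 = x" "\<forall>j\<in>{1..k}. a j \<le> b j" "\<forall>j\<in>{2..k}. b (j - 1) < a j"
    "\<forall>j\<in>{2..k}. b (j - 1) + M \<le> a j"
  then obtain y where
    y: "\<forall>j\<in>{1..k}. \<forall>i\<in>{a j..b j}. dist ((g ^^ i) y) ((g ^^ i) (xs j)) < \<epsilon>"
    using gap unfolding specification_gap_def by blast
  have "dist ((h ^^ i) y) ((h ^^ i) (xs j)) < \<epsilon> + 2 * \<eta>"
    if "j \<in> {1..k}" "i \<in> {a j..b j}" for i j
  proof -
    have "dist ((g ^^ i) y) ((h ^^ i) y) < \<eta>" "dist ((g ^^ i) (xs j)) ((h ^^ i) (xs j)) < \<eta>"
      using close by (simp_all add: iterates_close_def)
    moreover have "dist ((g ^^ i) y) ((g ^^ i) (xs j)) < \<epsilon>"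
      using y that by blast
    ultimately show ?thesis
      \<comment> \<open>The path goes from \<open>(h ^^ i) y\<close> through
        \<open>(g ^^ i) y\<close> and \<open>(g ^^ i) (xs j)\<close> to
        \<open>(h ^^ i) (xs j)\<close>, with steps below \<open>\<eta>\<close>,
        \<open>\<epsilon>\<close> and \<open>\<eta>\<close>.\<close>
      using dist_triangle3[of "(h ^^ i) y" "(h ^^ i) (xs j)" "(g ^^ i) y"]
        dist_triangle[of "(g ^^ i) y" "(h ^^ i) (xs j)" "(g ^^ i) (xs j)"] by linarith
  qed
  then show "\<exists>y. \<forall>j\<in>{1..k}. \<forall>i\<in>{a j..b j}. dist ((h ^^ i) y) ((h ^^ i) (xs j)) < \<epsilon> + 2 * \<eta>"
    by blast
qed

lemma Sp_at_transfer:
  assumes "iterates_close g h \<eta>" and "M \<in> Sp_at g x \<epsilon>"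
  shows "M \<in> Sp_at h x (\<epsilon> + 2 * \<eta>)"
  using assms specification_gap_transfer unfolding Sp_at_def by blast

text \<open>Puts both sides of the equivalence in terms of nonempty sets of admissible
  \<open>\<delta>\<close>, so that single elements can be transferred.\<close>

lemma Sh_plus_iff_Sh_plus_at: "x \<in> Sh_plus g \<longleftrightarrow> (\<forall>\<epsilon>>0. Sh_plus_at g x \<epsilon> \<noteq> {})"
  by (auto simp: Sh_plus_def Sh_plus_at_def)

lemma Sp_iff_Sp_at: "x \<in> Sp g \<longleftrightarrow> (\<forall>\<epsilon>>0. Sp_at g x \<epsilon> \<noteq> {})"
  by (auto simp: Sp_def Sp_at_def)

lemma Sh_plus_iff_eventually:
  assumes conv: "orbitally_convergent fs f"
  shows "x \<in> Sh_plus f \<longleftrightarrow> (\<forall>\<epsilon>>0. (\<Union>m\<in>{1..}. \<Inter>n\<in>{m..}. Sh_plus_at (fs n) x \<epsilon>) \<noteq> {})"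
  unfolding Sh_plus_iff_Sh_plus_at
proof (intro iffI allI impI)
  fix \<epsilon> :: real
  assume shadow: "\<forall>\<epsilon>>0. Sh_plus_at f x \<epsilon> \<noteq> {}" and "\<epsilon> > 0"
  then obtain \<delta> where \<delta>: "\<delta> \<in> Sh_plus_at f x (\<epsilon> / 2)"
    by (meson ex_in_conv half_gt_zero)
  then have "\<delta> > 0"
    by (simp add: Sh_plus_at_def)
  \<comment> \<open>The bound \<open>\<delta> / 2\<close> keeps \<open>\<delta> - \<eta>\<close>
    positive, and \<open>\<epsilon> / 2\<close> keeps the tracing error
    \<open>\<epsilon> / 2 + \<eta>\<close> within \<open>\<epsilon>\<close>.\<close>
  define \<eta> where "\<eta> = min (\<delta> / 2) (\<epsilon> / 2)"
  have \<eta>: "\<eta> > 0" "\<eta> \<le> \<delta> / 2" "\<eta> \<le> \<epsilon> / 2"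
    using \<open>\<delta> > 0\<close> \<open>\<epsilon> > 0\<close> by (auto simp: \<eta>_def)
  obtain N where "N \<ge> 1" and N: "\<And>n. n \<ge> N \<Longrightarrow> iterates_close (fs n) f \<eta>"
    using orbitally_convergent_iterates_close[OF conv \<open>\<eta> > 0\<close>] by blast
  \<comment> \<open>As \<open>\<eta>\<close> is fixed before \<open>n\<close>, the same number
    serves all \<open>n \<ge> N\<close> and lies in the intersection.\<close>
  have "\<delta> - \<eta> \<in> Sh_plus_at (fs n) x \<epsilon>" if "n \<ge> N" for n
  proof -
    have "\<delta> - \<eta> \<in> Sh_plus_at (fs n) x (\<epsilon> / 2 + \<eta>)"
      using N[OF that] \<delta> \<eta> \<open>\<delta> > 0\<close>
      by (intro Sh_plus_at_transfer[of f]) (simp_all add: iterates_close_commute)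
    then show ?thesis
      using \<eta> \<open>\<delta> > 0\<close> by (elim Sh_plus_at_mono) simp_all
  qed
  with \<open>N \<ge> 1\<close> show "(\<Union>m\<in>{1..}. \<Inter>n\<in>{m..}. Sh_plus_at (fs n) x \<epsilon>) \<noteq> {}"
    by fastforce
next
  fix \<epsilon> :: real
  assume shadow: "\<forall>\<epsilon>>0. (\<Union>m\<in>{1..}. \<Inter>n\<in>{m..}. Sh_plus_at (fs n) x \<epsilon>) \<noteq> {}" and "\<epsilon> > 0"
  then have "(\<Union>m\<in>{1..}. \<Inter>n\<in>{m..}. Sh_plus_at (fs n) x (\<epsilon> / 2)) \<noteq> {}"
    using half_gt_zero by blast
  then obtain m \<delta> where \<delta>: "\<And>n. n \<ge> m \<Longrightarrow> \<delta> \<in> Sh_plus_at (fs n) x (\<epsilon> / 2)"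
    by auto
  then have "\<delta> > 0"
    by (auto simp: Sh_plus_at_def)
  define \<eta> where "\<eta> = min (\<delta> / 2) (\<epsilon> / 2)"
  have \<eta>: "\<eta> > 0" "\<eta> \<le> \<delta> / 2" "\<eta> \<le> \<epsilon> / 2"
    using \<open>\<delta> > 0\<close> \<open>\<epsilon> > 0\<close> by (auto simp: \<eta>_def)
  obtain N where N: "\<And>n. n \<ge> N \<Longrightarrow> iterates_close (fs n) f \<eta>"
    using orbitally_convergent_iterates_close[OF conv \<open>\<eta> > 0\<close>] by blast
  \<comment> \<open>One map suffices here: at index \<open>max m N\<close>, \<open>\<delta>\<close>
    is admissible and the iterates are close to those of \<open>f\<close>.\<close>
  have "\<delta> - \<eta> \<in> Sh_plus_at f x (\<epsilon> / 2 + \<eta>)"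
    using N[of "max m N"] \<delta>[of "max m N"] \<eta> \<open>\<delta> > 0\<close>
    by (intro Sh_plus_at_transfer[of "fs (max m N)"]) simp_all
  then have "\<delta> - \<eta> \<in> Sh_plus_at f x \<epsilon>"
    using \<eta> \<open>\<delta> > 0\<close> by (elim Sh_plus_at_mono) simp_all
  then show "Sh_plus_at f x \<epsilon> \<noteq> {}"
    by blast
qed

text \<open>The transfer leaves \<open>M\<close> unchanged, so closeness depends on
  \<open>\<epsilon>\<close> alone: with \<open>\<eta> = \<epsilon> / 3\<close>, an initial error
  \<open>\<epsilon> / 3\<close> grows to
  \<open>\<epsilon> / 3 + 2 * (\<epsilon> / 3) = \<epsilon>\<close>.\<close>

lemma Sp_iff_eventually:
  assumes conv: "orbitally_convergent fs f"
  shows "x \<in> Sp f \<longleftrightarrow> (\<forall>\<epsilon>>0. (\<Union>m\<in>{1..}. \<Inter>n\<in>{m..}. Sp_at (fs n) x \<epsilon>) \<noteq> {})"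
  unfolding Sp_iff_Sp_at
proof (intro iffI allI impI)
  fix \<epsilon> :: real
  assume spec: "\<forall>\<epsilon>>0. Sp_at f x \<epsilon> \<noteq> {}" and "\<epsilon> > 0"
  then have "\<epsilon> / 3 > 0" by simp
  then obtain M where M: "M \<in> Sp_at f x (\<epsilon> / 3)"
    using spec by blast
  obtain N where "N \<ge> 1" and N: "\<And>n. n \<ge> N \<Longrightarrow> iterates_close (fs n) f (\<epsilon> / 3)"
    using orbitally_convergent_iterates_close[OF conv \<open>\<epsilon> / 3 > 0\<close>] by blast
  have "M \<in> Sp_at (fs n) x \<epsilon>" if "n \<ge> N" for n
    using Sp_at_transfer[of f "fs n" "\<epsilon> / 3" M x "\<epsilon> / 3"] N[OF that] M
    by (simp add: iterates_close_commute)
  with \<open>N \<ge> 1\<close> show "(\<Union>m\<in>{1..}. \<Inter>n\<in>{m..}. Sp_at (fs n) x \<epsilon>) \<noteq> {}"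
    by fastforce
next
  fix \<epsilon> :: real
  assume spec: "\<forall>\<epsilon>>0. (\<Union>m\<in>{1..}. \<Inter>n\<in>{m..}. Sp_at (fs n) x \<epsilon>) \<noteq> {}" and "\<epsilon> > 0"
  then have "\<epsilon> / 3 > 0" by simp
  then have "(\<Union>m\<in>{1..}. \<Inter>n\<in>{m..}. Sp_at (fs n) x (\<epsilon> / 3)) \<noteq> {}"
    using spec by blast
  then obtain m M where M: "\<And>n. n \<ge> m \<Longrightarrow> M \<in> Sp_at (fs n) x (\<epsilon> / 3)"
    by auto
  obtain N where N: "\<And>n. n \<ge> N \<Longrightarrow> iterates_close (fs n) f (\<epsilon> / 3)"
    using orbitally_convergent_iterates_close[OF conv \<open>\<epsilon> / 3 > 0\<close>] by blast
  have "M \<in> Sp_at f x \<epsilon>"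
    using Sp_at_transfer[OF N M, of "max m N"] by simp
  then show "Sp_at f x \<epsilon> \<noteq> {}"
    by blast
qed

theorem theorem3p6:
  fixes fs :: "nat \<Rightarrow> 'a::metric_space \<Rightarrow> 'a" and f :: "'a \<Rightarrow> 'a" and x :: 'a
  assumes "\<And>n. n \<ge> 1 \<Longrightarrow> uniformly_continuous_on UNIV (fs n)"
    and "uniformly_continuous_on UNIV f"
    and "orbitally_convergent fs f"
  shows "(x \<in> Sh_plus f \<longleftrightarrow>
            (\<forall>\<epsilon>>0. (\<Union>m\<in>{1..}. \<Inter>n\<in>{m..}. Sh_plus_at (fs n) x \<epsilon>) \<noteq> {}))
       \<and> (x \<in> Sp f \<longleftrightarrow>
            (\<forall>\<epsilon>>0. (\<Union>m\<in>{1..}. \<Inter>n\<in>{m..}. Sp_at (fs n) x \<epsilon>) \<noteq> {}))"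
  using Sh_plus_iff_eventually[OF assms(3)] Sp_iff_eventually[OF assms(3)] by blast

end
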